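(* Let $\gamma\geq 0$ and let $\delta=(\delta_j)_{j\in\mathcal{J}}\in\mathbb{R}^{\mathcal{J}}$ satisfy $\delta=\Phi^{\delta,\gamma}(\delta)$. Then $S_j^{(data)}=s_j(\delta)$ for all $j\in\mathcal{J}$.
   Context: Static random coefficient logit (BLP) model. $\mathcal{J}$ (products) and $\mathcal{I}$ (consumer types) are finite nonempty sets; $w_i\ge 0$ ($i\in\mathcal{I}$) are weights with $\sum_{i\in\mathcal{I}}w_i=1$; $\mu_{ij}\in\mathbb{R}$ ($i\in\mathcal{I},j\in\mathcal{J}$) are given. The observed shares $S_j^{(data)}>0$ ($j\in\mathcal{J}$) and $S_0^{(data)}>0$ satisfy $S_0^{(data)}+\sum_{j\in\mathcal{J}}S_j^{(data)}=1$. For $\delta\in\mathbb{R}^{\mathcal{J}}$ define $$s_j(\delta)=\sum_{i\in\mathcal{I}}w_i\frac{\exp(\delta_j+\mu_{ij})}{1+\sum_{k\in\mathcal{J}}\exp(\delta_k+\mu_{ik})}\ (j\in\mathcal{J}),\qquad s_0(\delta)=1-\sum_{k\in\mathcal{J}}s_k(\delta).$$ For $\gamma\in\mathbb{R}$ the mapping $\Phi^{\delta,\gamma}:\mathbb{R}^{\mathcal{J}}\to\mathbb{R}^{\mathcal{J}}$ is (the superscript $\delta$ is only a label) $$\Phi_j^{\delta,\gamma}(\delta)=\delta_j+\left[\log S_j^{(data)}-\log s_j(\delta)\right]-\gamma\left[\log S_0^{(data)}-\log s_0(\delta)\right].$$ *)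

theory Defs
  imports "HOL-Analysis.Analysis"
begin

text \<open>
  The finite nonempty sets of consumer types and products are the finite types \<open>'i\<close> and \<open>'j\<close>;
  the outside good, with mean utility normalised to 0, is not an element of \<open>'j\<close>.
\<close>

definition share :: "('i::finite \<Rightarrow> real) \<Rightarrow> ('i \<Rightarrow> 'j::finite \<Rightarrow> real) \<Rightarrow> real ^ 'j \<Rightarrow> 'j \<Rightarrow> real"
  where "share w \<mu> \<delta> j =
    (\<Sum>i\<in>UNIV. w i * (exp (\<delta> $ j + \<mu> i j) / (1 + (\<Sum>k\<in>UNIV. exp (\<delta> $ k + \<mu> i k)))))"

definition outside_share :: "('i::finite \<Rightarrow> real) \<Rightarrow> ('i \<Rightarrow> 'j::finite \<Rightarrow> real) \<Rightarrow> real ^ 'j \<Rightarrow> real"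
  where "outside_share w \<mu> \<delta> = 1 - (\<Sum>k\<in>UNIV. share w \<mu> \<delta> k)"

text \<open>\<open>S\<close> and \<open>S0\<close> are the observed shares of the products and of the outside good.\<close>

definition Phi ::
  "('i::finite \<Rightarrow> real) \<Rightarrow> ('i \<Rightarrow> 'j::finite \<Rightarrow> real) \<Rightarrow> ('j \<Rightarrow> real) \<Rightarrow> real \<Rightarrow> real
    \<Rightarrow> real ^ 'j \<Rightarrow> real ^ 'j"
  where "Phi w \<mu> S S0 \<gamma> \<delta> =
    (\<chi> j. \<delta> $ j + (ln (S j) - ln (share w \<mu> \<delta> j))
           - \<gamma> * (ln S0 - ln (outside_share w \<mu> \<delta>)))"

end

theory Submission
  imports Defs
begin

text \<open>
  At a fixed point \<open>ln S\<^sub>j - ln s\<^sub>j = \<gamma> (ln S\<^sub>0 - ln s\<^sub>0)\<close> for every \<open>j\<close>. Since \<open>\<gamma> \<ge> 0\<close>, if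
  \<open>S\<^sub>0 > s\<^sub>0\<close> then no inside share can compensate, \<open>S\<^sub>j \<ge> s\<^sub>j\<close>, although both share vectors sum
  to 1; the case \<open>S\<^sub>0 < s\<^sub>0\<close> is symmetric. Hence \<open>S\<^sub>0 = s\<^sub>0\<close>, and then \<open>S\<^sub>j = s\<^sub>j\<close>.
\<close>

text \<open>Weights summing to 1 cannot all vanish, so some term is strictly positive while the
  others are nonnegative.\<close>

lemma sum_weights_pos:
  fixes w f :: "'i::finite \<Rightarrow> real"
  assumes "\<And>i. w i \<ge> 0" "(\<Sum>i\<in>UNIV. w i) = 1" "\<And>i. f i > 0"
  shows "(\<Sum>i\<in>UNIV. w i * f i) > 0"
proof -
  obtain i where "w i \<noteq> 0"
    using assms(2) by (metis sum.neutral zero_neq_one)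
  then have "w i * f i > 0"
    using assms(1)[of i] assms(3)[of i] by simp
  moreover have "w k * f k \<ge> 0" for k
    using assms(1)[of k] assms(3)[of k] by simp
  ultimately show ?thesis
    by (intro sum_pos2[of UNIV i]) auto
qed

lemma logit_denominator_pos: "1 + (\<Sum>k\<in>UNIV. exp (x k :: real)) > 0"
  by (simp add: add_pos_nonneg sum_nonneg)

lemma share_pos:
  assumes "\<And>i. w i \<ge> 0" "(\<Sum>i\<in>UNIV. w i) = 1"
  shows "share w \<mu> \<delta> j > 0"
  unfolding share_def
  by (intro sum_weights_pos assms divide_pos_pos exp_gt_zero logit_denominator_pos)

text \<open>For each type the inside choice probabilities leave exactly 1 / (1 + D). Unlike the
  residual definition, this form makes positivity visible.\<close>

lemma outside_share_eq:
  assumes "(\<Sum>i\<in>UNIV. w i) = 1"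
  shows "outside_share w \<mu> \<delta> =
    (\<Sum>i\<in>UNIV. w i * (1 / (1 + (\<Sum>k\<in>UNIV. exp (\<delta> $ k + \<mu> i k)))))"
proof -
  define D where "D i = (\<Sum>k\<in>UNIV. exp (\<delta> $ k + \<mu> i k))" for i
  have "1 + D i \<noteq> 0" for i
    using logit_denominator_pos[of "\<lambda>k. \<delta> $ k + \<mu> i k"] by (simp add: D_def)
  then have D: "1 - D i / (1 + D i) = 1 / (1 + D i)" for i
    by (simp add: divide_simps)
  have "(\<Sum>j\<in>UNIV. share w \<mu> \<delta> j) =
      (\<Sum>i\<in>UNIV. \<Sum>j\<in>UNIV. w i * (exp (\<delta> $ j + \<mu> i j) / (1 + D i)))"
    unfolding share_def D_def by (rule sum.swap)
  also have "\<dots> = (\<Sum>i\<in>UNIV. w i * (D i / (1 + D i)))"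
    by (simp add: D_def sum_distrib_left sum_divide_distrib)
  finally have "outside_share w \<mu> \<delta> = (\<Sum>i\<in>UNIV. w i * (1 - D i / (1 + D i)))"
    by (simp add: outside_share_def assms right_diff_distrib sum_subtractf)
  then show ?thesis
    by (simp only: D) (simp add: D_def)
qed

lemma outside_share_pos:
  assumes "\<And>i. w i \<ge> 0" "(\<Sum>i\<in>UNIV. w i) = 1"
  shows "outside_share w \<mu> \<delta> > 0"
  unfolding outside_share_eq[OF assms(2)]
  by (intro sum_weights_pos assms divide_pos_pos zero_less_one logit_denominator_pos)

theorem proposition1:
  fixes w :: "'i::finite \<Rightarrow> real"
    and \<mu> :: "'i \<Rightarrow> 'j::finite \<Rightarrow> real"
    and S :: "'j \<Rightarrow> real"
    and S0 :: real
    and \<gamma> :: real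
    and \<delta> :: "real ^ 'j"
  assumes "\<And>i. w i \<ge> 0"
    and "(\<Sum>i\<in>UNIV. w i) = 1"
    and "\<And>j. S j > 0"
    and "S0 > 0"
    and "S0 + (\<Sum>j\<in>UNIV. S j) = 1"
    and "\<gamma> \<ge> 0"
    and "\<delta> = Phi w \<mu> S S0 \<gamma> \<delta>"
  shows "\<forall>j. S j = share w \<mu> \<delta> j"
proof -
  let ?s = "share w \<mu> \<delta>" and ?out = "outside_share w \<mu> \<delta>"
  \<comment> \<open>Positivity of all shares is what lets inequalities between logarithms be read as
    inequalities between shares.\<close>
  have s: "?s j > 0" for j
    using assms(1,2) by (rule share_pos)
  have s0: "?out > 0"
    using assms(1,2) by (rule outside_share_pos)
  have total: "S0 + (\<Sum>j\<in>UNIV. S j) = ?out + (\<Sum>j\<in>UNIV. ?s j)"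
    using assms(5) by (simp add: outside_share_def)
  have fixpoint: "ln (S j) - ln (?s j) = \<gamma> * (ln S0 - ln ?out)" for j
    using arg_cong[OF assms(7), of "\<lambda>x. x $ j"] by (simp add: Phi_def)
  have "S0 = ?out"
  proof (rule linorder_cases)
    assume less: "S0 < ?out"
    then have "\<gamma> * (ln S0 - ln ?out) \<le> 0"
      using assms(4,6) s0 by (intro mult_nonneg_nonpos) auto
    then have "S j \<le> ?s j" for j
      using fixpoint[of j] assms(3)[of j] s[of j]
      by (metis diff_le_0_iff_le ln_le_cancel_iff)
    \<comment> \<open>Contradiction: summing over \<open>j\<close> makes the left side of
      \<open>total\<close> strictly smaller than the right.\<close>
    then show ?thesis
      using less total sum_mono[of UNIV S ?s] by fastforce
  next
    assume less: "?out < S0"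
    then have "\<gamma> * (ln S0 - ln ?out) \<ge> 0"
      using assms(4,6) s0 by (intro mult_nonneg_nonneg) auto
    then have "?s j \<le> S j" for j
      using fixpoint[of j] assms(3)[of j] s[of j]
      by (metis diff_ge_0_iff_ge ln_le_cancel_iff)
    then show ?thesis
      using less total sum_mono[of UNIV ?s S] by fastforce
  qed
  \<comment> \<open>The right side of \<open>fixpoint\<close> is now 0, and \<open>ln\<close> is
    injective on positive reals.\<close>
  then show ?thesis
    using fixpoint assms(3) s by simp
qed

end
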